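(* Let $\mathbb{H}_1,\mathbb{H}_2$ be Hilbert spaces over the same field (real or complex) and let $T\in\mathbb{L}(\mathbb{H}_1,\mathbb{H}_2)$. Given any $x\in S_{\mathbb{H}_1}$, the following are equivalent: (i) $x\in m_T$. (ii) Both of the following hold: (a) for every $y\in\mathbb{H}_1$, $\langle x,y\rangle=0$ implies $\langle Tx,Ty\rangle=0$; (b) $\inf\{\|Ty\|:\ y\in\mathbb{H}_1,\ \|y\|=1,\ \langle x,y\rangle=0\}\ge\|Tx\|$. (iii) $\langle Tx,Ty\rangle=m(T)^2\langle x,y\rangle$ for every $y\in\mathbb{H}_1$.
   Context: $S_{\mathbb{H}_1}$ is the unit sphere of $\mathbb{H}_1$; $\mathbb{L}(\mathbb{H}_1,\mathbb{H}_2)$ is the space of bounded linear operators from $\mathbb{H}_1$ to $\mathbb{H}_2$. For such $T$, $m(T)=\inf\{\|Tx\|:\|x\|=1\}$, and the minimum norm attainment set is $m_T=\{x\in S_{\mathbb{H}_1}:\|Tx\|=m(T)\}$. The infimum of the empty set is $+\infty$. *)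

theory Defs
  imports "HOL-Analysis.Analysis" "HOL-Library.Extended_Real"
begin

text \<open>
  The scalar field: a real normed field with a conjugation. The third axiom forces
  \<open>conjg x = of_real ((norm x)\<^sup>2) / x\<close> for \<open>x \<noteq> 0\<close>, and also that every \<open>x\<close> is a root of a monic
  real quadratic; hence, up to isomorphism, the only models are the real field with trivial
  conjugation and the complex field with complex conjugation, which are the instances below.
\<close>

class real_or_complex = real_normed_field +
  fixes conjg :: "'a \<Rightarrow> 'a"
  assumes conjg_add: "conjg (x + y) = conjg x + conjg y"
    and conjg_mult: "conjg (x * y) = conjg x * conjg y"
    and mult_conjg: "x * conjg x = (norm x)\<^sup>2 *\<^sub>R 1"

instantiation real :: real_or_complex
begin
definition conjg_real :: "real \<Rightarrow> real" where "conjg_real x = x"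
instance by standard (simp_all add: conjg_real_def power2_eq_square)
end

instantiation complex :: real_or_complex
begin
definition conjg_complex :: "complex \<Rightarrow> complex" where "conjg_complex = cnj"
instance by standard
  (simp_all add: conjg_complex_def scaleR_conv_of_real complex_norm_square del: of_real_power)
end

text \<open>
  A Hilbert space over \<open>'k\<close>. Completeness and the norm come from the type classes;
  \<open>inner_self\<close> says that this norm is the one induced by the inner product, and so
  contains its positive definiteness. The inner product is linear in the first argument.
\<close>

locale hilbert_space = vector_space scale
  for scale :: "'k::real_or_complex \<Rightarrow> 'a::{real_normed_vector, complete_space} \<Rightarrow> 'a" +
  fixes ip :: "'a \<Rightarrow> 'a \<Rightarrow> 'k"
  assumes scale_of_real: "scale (of_real r) x = r *\<^sub>R x"
    and inner_add_left: "ip (x + y) z = ip x z + ip y z"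
    and inner_scale_left: "ip (scale c x) y = c * ip x y"
    and inner_commute: "ip y x = conjg (ip x y)"
    and inner_self: "ip x x = of_real ((norm x)\<^sup>2)"

lemma hilbert_space_real_inner:
  "hilbert_space scaleR (inner :: 'a::{real_inner, complete_space} \<Rightarrow> 'a \<Rightarrow> real)"
  by unfold_locales
    (auto simp: algebra_simps conjg_real_def inner_commute power2_norm_eq_inner)

lemma hilbert_space_complex:
  "hilbert_space (*) (\<lambda>x y :: complex. x * cnj y)"
  by unfold_locales
    (auto simp: algebra_simps conjg_complex_def scaleR_conv_of_real complex_norm_square simp del: of_real_power)

definition bounded_operator ::
  "('k::field \<Rightarrow> 'a::real_normed_vector \<Rightarrow> 'a) \<Rightarrow> ('k \<Rightarrow> 'b::real_normed_vector \<Rightarrow> 'b)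
    \<Rightarrow> ('a \<Rightarrow> 'b) \<Rightarrow> bool"
  where "bounded_operator scale1 scale2 T \<longleftrightarrow>
    Vector_Spaces.linear scale1 scale2 T \<and> (\<exists>K. \<forall>x. norm (T x) \<le> norm x * K)"

lemma bounded_operator_scaleR: "bounded_operator scaleR scaleR T \<longleftrightarrow> bounded_linear T"
  by (simp add: bounded_operator_def bounded_linear_def bounded_linear_axioms_def
      Real_Vector_Spaces.linear_def real_scaleR_def)

text \<open>A real infimum: meaningful whenever the unit sphere is nonempty, i.e. the domain is not \<open>{0}\<close>.\<close>

definition min_norm :: "('a::real_normed_vector \<Rightarrow> 'b::real_normed_vector) \<Rightarrow> real"
  where "min_norm T = (INF x\<in>sphere 0 1. norm (T x))"

definition min_norm_attainment ::
  "('a::real_normed_vector \<Rightarrow> 'b::real_normed_vector) \<Rightarrow> 'a set"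
  where "min_norm_attainment T = {x \<in> sphere 0 1. norm (T x) = min_norm T}"

end

theory Submission
  imports Defs
begin

text \<open>
  The form \<open>f z = \<parallel>T z\<parallel>\<^sup>2 - m(T)\<^sup>2 \<parallel>z\<parallel>\<^sup>2\<close> is nonnegative and vanishes at \<open>x\<close> exactly when
  \<open>x\<close> attains the minimum norm. Then the first variation
  \<open>D = \<langle>T x, T y\<rangle> - m(T)\<^sup>2 \<langle>x, y\<rangle>\<close> of \<open>f\<close> at \<open>x\<close> vanishes in each direction \<open>y\<close>, which is (iii).
  Conversely, under (ii) the orthogonal decomposition \<open>z = c x + w\<close> of a vector is
  mapped to an orthogonal decomposition of \<open>T z\<close>, and Pythagoras gives \<open>\<parallel>T z\<parallel> \<ge> \<parallel>T x\<parallel> \<parallel>z\<parallel>\<close>.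
\<close>

lemma conjg_0 [simp]: "conjg (0::'k::real_or_complex) = 0"
  using conjg_add[of "0::'k" 0] by simp

lemma conjg_minus: "conjg (- x) = - conjg (x::'k::real_or_complex)"
  using conjg_add[of x "- x"] by (simp add: eq_neg_iff_add_eq_0 add.commute)

lemma conjg_diff: "conjg (x - y) = conjg x - conjg (y::'k::real_or_complex)"
  using conjg_add[of x "- y"] by (simp add: conjg_minus)

lemma mult_conjg_of_real: "x * conjg x = (of_real ((norm x)\<^sup>2) :: 'k::real_or_complex)"
  using mult_conjg[of x] by (simp add: scaleR_conv_of_real)

text \<open>The axiom relating \<open>conjg\<close> to the norm gives the claim multiplied by
  \<open>of_real r\<close>, a factor that cancels unless \<open>r = 0\<close>.\<close>

lemma conjg_of_real [simp]: "conjg (of_real r) = (of_real r :: 'k::real_or_complex)"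
proof (cases "r = 0")
  case False
  have "of_real r * conjg (of_real r) = (of_real r * of_real r :: 'k)"
    using mult_conjg_of_real[of "of_real r :: 'k"] by (simp add: power2_eq_square)
  with False show ?thesis by simp
qed simp

context hilbert_space
begin

lemma inner_add_right: "ip x (y + z) = ip x y + ip x z"
  by (metis inner_commute conjg_add inner_add_left)

lemma inner_scale_right: "ip x (scale c y) = conjg c * ip x y"
  by (metis inner_commute conjg_mult inner_scale_left)

text \<open>The locale ties the norm to scaling only for real scalars; for general ones homogeneity
  comes from expanding \<open>ip (scale c x) (scale c x)\<close>.\<close>

lemma norm_scale: "norm (scale c x) = norm c * norm x"
proof -
  have "(of_real ((norm (scale c x))\<^sup>2) :: 'k) = (c * conjg c) * ip x x"
    by (simp only: inner_self[symmetric] inner_scale_left inner_scale_right ac_simps)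
  also have "\<dots> = of_real ((norm c * norm x)\<^sup>2)"
    by (simp add: mult_conjg_of_real inner_self power_mult_distrib)
  finally have "(norm (scale c x))\<^sup>2 = (norm c * norm x)\<^sup>2"
    by (simp only: of_real_eq_iff)
  then show ?thesis by (simp add: power2_eq_iff_nonneg)
qed

lemma norm_add_sq:
  "of_real ((norm (x + y))\<^sup>2) = of_real ((norm x)\<^sup>2) + of_real ((norm y)\<^sup>2) + (ip x y + ip y x)"
  by (simp only: inner_self[symmetric] inner_add_left inner_add_right ac_simps)

lemma norm_add_sq_orthogonal:
  assumes "ip x y = 0"
  shows "(norm (x + y))\<^sup>2 = (norm x)\<^sup>2 + (norm y)\<^sup>2"
proof -
  have "ip y x = 0" using inner_commute[of y x] assms by simp
  with assms have "(of_real ((norm (x + y))\<^sup>2) :: 'k) = of_real ((norm x)\<^sup>2 + (norm y)\<^sup>2)"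
    by (simp add: norm_add_sq del: of_real_power)
  then show ?thesis by (simp only: of_real_eq_iff)
qed

lemma orthogonal_decomposition:
  assumes "norm x = 1"
  obtains c w where "z = scale c x + w" "ip x w = 0"
proof
  \<comment> \<open>Because \<open>ip\<close> is linear in its first argument, the coefficient of
    the projection onto the unit vector \<open>x\<close> is \<open>ip z x\<close>, not
    \<open>ip x z\<close>.\<close>
  let ?w = "z + scale (- ip z x) x"
  show "z = scale (ip z x) x + ?w" by simp
  have "ip ?w x = 0"
    using assms by (simp only: inner_add_left inner_scale_left inner_self) simp
  then show "ip x ?w = 0" using inner_commute[of x ?w] by simp
qed

end

lemma min_norm_le:
  assumes "norm z = 1"
  shows "min_norm T \<le> norm (T z)"
  unfolding min_norm_def
  by (rule cINF_lower) (use assms in \<open>auto intro: bdd_belowI[of _ 0]\<close>)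

text \<open>The unit vector guarantees a nonempty sphere, without which the real infimum has no
  useful value.\<close>

lemma min_norm_nonneg:
  assumes "norm (x :: 'a::real_normed_vector) = 1"
  shows "0 \<le> min_norm (T :: 'a \<Rightarrow> 'b::real_normed_vector)"
  unfolding min_norm_def by (rule cINF_greatest) (use assms in auto)

lemma mem_min_norm_attainment_iff:
  assumes "norm x = 1"
  shows "x \<in> min_norm_attainment T \<longleftrightarrow> (\<forall>z. norm z = 1 \<longrightarrow> norm (T x) \<le> norm (T z))"
proof
  assume "x \<in> min_norm_attainment T"
  then show "\<forall>z. norm z = 1 \<longrightarrow> norm (T x) \<le> norm (T z)"
    using min_norm_le[of _ T] by (simp add: min_norm_attainment_def)
next
  assume "\<forall>z. norm z = 1 \<longrightarrow> norm (T x) \<le> norm (T z)"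
  then have "norm (T x) \<le> min_norm T"
    unfolding min_norm_def by (intro cINF_greatest) (use assms in auto)
  with min_norm_le[of x T] assms show "x \<in> min_norm_attainment T"
    by (simp add: min_norm_attainment_def)
qed

locale hilbert_linear =
  H1: hilbert_space scale1 ip1 + H2: hilbert_space scale2 ip2 +
  Vector_Spaces.linear scale1 scale2 T
  for scale1 :: "'k::real_or_complex \<Rightarrow> 'a::{real_normed_vector, complete_space} \<Rightarrow> 'a"
    and ip1 :: "'a \<Rightarrow> 'a \<Rightarrow> 'k"
    and scale2 :: "'k \<Rightarrow> 'b::{real_normed_vector, complete_space} \<Rightarrow> 'b"
    and ip2 :: "'b \<Rightarrow> 'b \<Rightarrow> 'k"
    and T :: "'a \<Rightarrow> 'b"
begin

lemma T_scaleR: "T (r *\<^sub>R z) = r *\<^sub>R T z"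
  using scale[of "of_real r" z] by (simp add: H1.scale_of_real H2.scale_of_real)

text \<open>Carries a bound from the unit sphere to all vectors by rescaling; at
  \<open>z = 0\<close> both sides vanish.\<close>

lemma norm_ge_homogeneous:
  assumes "z \<noteq> 0 \<Longrightarrow> b \<le> norm (T ((1 / norm z) *\<^sub>R z))"
  shows "b * norm z \<le> norm (T z)"
proof (cases "z = 0")
  case False
  with assms show ?thesis by (simp add: T_scaleR field_simps)
qed simp

lemma first_variation_eq_zero:
  assumes nonneg: "\<And>z. m\<^sup>2 * (norm z)\<^sup>2 \<le> (norm (T z))\<^sup>2"
    and zero: "(norm (T x))\<^sup>2 = m\<^sup>2 * (norm x)\<^sup>2"
  shows "ip2 (T x) (T y) = of_real (m\<^sup>2) * ip1 x y"
proof -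
  define D where "D = ip2 (T x) (T y) - of_real (m\<^sup>2) * ip1 x y"
  define f where "f z = (norm (T z))\<^sup>2 - m\<^sup>2 * (norm z)\<^sup>2" for z
  have conjg_D: "conjg D = ip2 (T y) (T x) - of_real (m\<^sup>2) * ip1 y x"
    unfolding D_def conjg_diff conjg_mult conjg_of_real
      H1.inner_commute[of y x] H2.inner_commute[of "T y" "T x"] ..
  have "D = 0"
  proof (rule ccontr)
    assume "D \<noteq> 0"
    \<comment> \<open>The abstract field has no real part. Requiring both cross terms to equal the
      same real \<open>r\<close> takes its place and makes the linear term
      \<open>2 * r\<close>.\<close>
    have expand: "f (x + scale1 c y) = (norm c)\<^sup>2 * f y + 2 * r"
      if "conjg c * D = of_real r" "c * conjg D = of_real r" for c r
    proof -
      have "(of_real (f (x + scale1 c y)) :: 'k)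
          = of_real ((norm (T x))\<^sup>2 - m\<^sup>2 * (norm x)\<^sup>2) + of_real ((norm c)\<^sup>2 * f y)
            + (conjg c * D + c * conjg D)"
        \<comment> \<open>\<open>conjg D\<close> has to become inner products before
          \<open>D_def\<close> replaces the \<open>D\<close> inside it.\<close>
        unfolding conjg_D unfolding f_def D_def add scale of_real_diff of_real_mult
          H1.norm_add_sq H2.norm_add_sq H1.norm_scale H2.norm_scale power_mult_distrib
          H1.inner_scale_left H2.inner_scale_left H1.inner_scale_right H2.inner_scale_right
        by (simp add: algebra_simps)
      also have "\<dots> = of_real ((norm c)\<^sup>2 * f y + 2 * r)"
        unfolding that zero by simp
      finally show ?thesis by (simp only: of_real_eq_iff)
    qed
    \<comment> \<open>A step small enough that, for \<open>c = - t D\<close>, the quadratic term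
      \<open>t\<^sup>2 |D|\<^sup>2 f y\<close> stays below the linear gain
      \<open>2 t |D|\<^sup>2\<close>; the \<open>+ 1\<close> covers \<open>f y = 0\<close>.\<close>
    define t where "t = 1 / (f y + 1)"
    have fy: "0 \<le> f y" using nonneg[of y] by (simp add: f_def)
    then have t: "0 < t" "t * f y < 2" by (simp_all add: t_def field_simps)
    define c where "c = - (of_real t * D)"
    have r: "conjg c * D = of_real (- (t * (norm D)\<^sup>2))" "c * conjg D = of_real (- (t * (norm D)\<^sup>2))"
      using mult_conjg_of_real[of D]
      by (simp_all add: c_def conjg_minus conjg_mult mult.assoc mult.commute[of "conjg D"])
    have "0 \<le> f (x + scale1 c y)" using nonneg by (simp add: f_def)
    also have "\<dots> = (t * (norm D)\<^sup>2) * (t * f y - 2)"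
      unfolding expand[OF r] by (simp add: c_def norm_mult power2_eq_square algebra_simps)
    also have "\<dots> < 0"
      using t \<open>D \<noteq> 0\<close> by (intro mult_pos_neg) auto
    finally show False by simp
  qed
  then show ?thesis by (simp add: D_def)
qed

lemma norm_ge_of_orthogonal:
  assumes "norm x = 1"
    and orth: "\<And>y. ip1 x y = 0 \<Longrightarrow> ip2 (T x) (T y) = 0"
    and ge: "\<And>y. norm y = 1 \<Longrightarrow> ip1 x y = 0 \<Longrightarrow> norm (T x) \<le> norm (T y)"
  shows "norm (T x) * norm z \<le> norm (T z)"
proof -
  obtain c w where z: "z = scale1 c x + w" and w: "ip1 x w = 0"
    using H1.orthogonal_decomposition assms(1) by blast
  \<comment> \<open>Normalising \<open>w\<close> keeps it orthogonal to \<open>x\<close>, so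
    \<open>ge\<close> applies to it.\<close>
  have "ip1 x ((1 / norm w) *\<^sub>R w) = 0"
    using w H1.inner_scale_right[of x "of_real (1 / norm w)" w] by (simp only: H1.scale_of_real) simp
  then have "norm (T x) * norm w \<le> norm (T w)"
    by (intro norm_ge_homogeneous ge) auto
  then have Tw: "(norm (T x) * norm w)\<^sup>2 \<le> (norm (T w))\<^sup>2"
    by (intro power_mono) auto
  have "(norm (T x) * norm z)\<^sup>2 = (norm (T x))\<^sup>2 * (norm z)\<^sup>2"
    by (rule power_mult_distrib)
  also have "(norm z)\<^sup>2 = (norm c)\<^sup>2 + (norm w)\<^sup>2"
    unfolding z using H1.norm_add_sq_orthogonal[of "scale1 c x" w] w assms(1)
    by (simp add: H1.inner_scale_left H1.norm_scale)
  also have "(norm (T x))\<^sup>2 * \<dots> \<le> (norm c * norm (T x))\<^sup>2 + (norm (T w))\<^sup>2"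
    using Tw by (simp add: power_mult_distrib algebra_simps)
  also have "\<dots> = (norm (T z))\<^sup>2"
    unfolding z add scale
    using H2.norm_add_sq_orthogonal[of "scale2 c (T x)" "T w"] orth[OF w]
    by (simp add: H2.inner_scale_left H2.norm_scale)
  finally show ?thesis by (rule power2_le_imp_le) simp
qed

end

theorem theorem2p4:
  fixes scale1 :: "'k::real_or_complex \<Rightarrow> 'a::{real_normed_vector, complete_space} \<Rightarrow> 'a"
    and ip1 :: "'a \<Rightarrow> 'a \<Rightarrow> 'k"
    and scale2 :: "'k \<Rightarrow> 'b::{real_normed_vector, complete_space} \<Rightarrow> 'b"
    and ip2 :: "'b \<Rightarrow> 'b \<Rightarrow> 'k"
    and T :: "'a \<Rightarrow> 'b"
    and x :: 'a
  assumes "hilbert_space scale1 ip1"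
    and "hilbert_space scale2 ip2"
    and "bounded_operator scale1 scale2 T"
    and "x \<in> sphere 0 1"
  shows "(x \<in> min_norm_attainment T \<longleftrightarrow>
            (\<forall>y. ip1 x y = 0 \<longrightarrow> ip2 (T x) (T y) = 0) \<and>
            (INF y\<in>{y. norm y = 1 \<and> ip1 x y = 0}. ereal (norm (T y))) \<ge> ereal (norm (T x)))
       \<and> (x \<in> min_norm_attainment T \<longleftrightarrow>
            (\<forall>y. ip2 (T x) (T y) = of_real ((min_norm T)\<^sup>2) * ip1 x y))"
proof -
  from assms(1-3) interpret hilbert_linear scale1 ip1 scale2 ip2 T
    by (simp add: hilbert_linear_def bounded_operator_def)
  let ?m = "min_norm T"
  have x: "norm x = 1" using assms(4) by simp
  have iii: "ip2 (T x) (T y) = of_real (?m\<^sup>2) * ip1 x y" if "x \<in> min_norm_attainment T" for y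
  proof (rule first_variation_eq_zero)
    show "?m\<^sup>2 * (norm z)\<^sup>2 \<le> (norm (T z))\<^sup>2" for z
    proof -
      have "?m * norm z \<le> norm (T z)"
        by (intro norm_ge_homogeneous min_norm_le) simp
      then have "(?m * norm z)\<^sup>2 \<le> (norm (T z))\<^sup>2"
        using min_norm_nonneg[OF x, of T] by (intro power_mono) auto
      then show ?thesis by (simp add: power_mult_distrib)
    qed
    show "(norm (T x))\<^sup>2 = ?m\<^sup>2 * (norm x)\<^sup>2"
      using that x by (simp add: min_norm_attainment_def)
  qed
  have i: "x \<in> min_norm_attainment T" if "\<forall>y. ip2 (T x) (T y) = of_real (?m\<^sup>2) * ip1 x y"
  proof -
    \<comment> \<open>The choice \<open>y = x\<close> in (iii) already forces attainment.\<close>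
    have "(of_real ((norm (T x))\<^sup>2) :: 'k) = of_real (?m\<^sup>2)"
      using that[rule_format, of x] x unfolding H1.inner_self H2.inner_self by simp
    then have "(norm (T x))\<^sup>2 = ?m\<^sup>2" by (simp only: of_real_eq_iff)
    then show ?thesis
      using x min_norm_nonneg[OF x, of T] by (simp add: min_norm_attainment_def power2_eq_iff_nonneg)
  qed
  \<comment> \<open>In dimension one no unit vector is orthogonal to \<open>x\<close>: the
    \<open>ereal\<close> infimum is then infinite and the right-hand side vacuous, so the
    equivalence still holds.\<close>
  have INF_iff: "(INF y\<in>{y. norm y = 1 \<and> ip1 x y = 0}. ereal (norm (T y))) \<ge> ereal (norm (T x))
      \<longleftrightarrow> (\<forall>y. norm y = 1 \<and> ip1 x y = 0 \<longrightarrow> norm (T x) \<le> norm (T y))"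
    by (simp add: le_INF_iff)
  have "x \<in> min_norm_attainment T \<longleftrightarrow>
      (\<forall>y. ip1 x y = 0 \<longrightarrow> ip2 (T x) (T y) = 0) \<and>
      (INF y\<in>{y. norm y = 1 \<and> ip1 x y = 0}. ereal (norm (T y))) \<ge> ereal (norm (T x))"
    (is "?i \<longleftrightarrow> ?ii")
  proof
    assume ?i
    \<comment> \<open>Orthogonality of the images is (iii) with \<open>ip1 x y = 0\<close>; the
      bound is minimality restricted to the unit vectors orthogonal to \<open>x\<close>.\<close>
    then show ?ii
      unfolding INF_iff using iii mem_min_norm_attainment_iff[OF x, of T] by auto
  next
    assume ?ii
    then have "norm (T x) * norm z \<le> norm (T z)" for z
      unfolding INF_iff by (intro norm_ge_of_orthogonal x) auto
    then show ?i
      unfolding mem_min_norm_attainment_iff[OF x] by (metis mult.right_neutral)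
  qed
  with i iii show ?thesis by blast
qed

end
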